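(* Let $n\ge3$ and consider the Matukuma equation $$-\Delta u=\frac1{1+|x|^2}u^p\quad\text{and}\quad u>0\quad\text{in }\mathbb R^n.$$ If $1\le p\le n/(n-2)$, then any smooth solution must be radially symmetric about the origin. If $0\le p<1$, the equation has no smooth solutions. *)

theory Defs
  imports "HOL-Analysis.Analysis"
begin

definition partial_deriv :: "'n::finite \<Rightarrow> (real ^ 'n \<Rightarrow> real) \<Rightarrow> real ^ 'n \<Rightarrow> real"
  where "partial_deriv i f x = frechet_derivative f (at x) (axis i 1)"

(* C^k on all of R^n.  The total derivative is required to exist at every stage, so that
   partial_deriv, whose value is unspecified where f is not differentiable, is meaningful. *)
primrec Ck :: "nat \<Rightarrow> (real ^ 'n::finite \<Rightarrow> real) \<Rightarrow> bool"
  where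
    "Ck 0 f \<longleftrightarrow> continuous_on UNIV f"
  | "Ck (Suc k) f \<longleftrightarrow> f differentiable_on UNIV \<and> (\<forall>i. Ck k (partial_deriv i f))"

definition smooth :: "(real ^ 'n::finite \<Rightarrow> real) \<Rightarrow> bool"
  where "smooth f \<longleftrightarrow> (\<forall>k. Ck k f)"

definition laplacian :: "(real ^ 'n::finite \<Rightarrow> real) \<Rightarrow> real ^ 'n \<Rightarrow> real"
  where "laplacian f x = (\<Sum>i\<in>UNIV. partial_deriv i (partial_deriv i f) x)"

(* For u x > 0, powr is the usual real power; in particular u x powr 0 = 1. *)
definition matukuma_solution :: "real \<Rightarrow> (real ^ 'n::finite \<Rightarrow> real) \<Rightarrow> bool"
  where "matukuma_solution p u \<longleftrightarrow>
    (\<forall>x. - laplacian u x = 1 / (1 + (norm x)\<^sup>2) * u x powr p \<and> u x > 0)"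

definition radially_symmetric :: "(real ^ 'n::finite \<Rightarrow> real) \<Rightarrow> bool"
  where "radially_symmetric u \<longleftrightarrow> (\<exists>g. \<forall>x. u x = g (norm x))"

end

theory Submission
  imports Defs
begin

text \<open>
  Let \<open>n\<close> be the dimension.

  \<^bold>\<open>Nonexistence for\<close> \<open>0 \<le> p < 1\<close>.  The function \<open>w = u\<^bsup>1 - p\<^esup> / (1 - p)\<close> satisfies \<open>- \<Delta> w \<ge> 1 / (1 + \<bar>x\<bar>\<^sup>2)\<close>,
  and \<open>\<Delta> ln (1 + \<bar>x\<bar>\<^sup>2) \<le> 2 n / (1 + \<bar>x\<bar>\<^sup>2)\<close>.  Hence \<open>w + ln (1 + \<bar>x\<bar>\<^sup>2) / (4 n)\<close> has negative Laplacian
  everywhere; being positive apart from the logarithm, it tends to infinity and so has a minimum, where the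
  Laplacian cannot be negative (\<open>no_positive_sublinear_solution\<close>).

  \<^bold>\<open>Symmetry for\<close> \<open>1 \<le> p \<le> n / (n - 2)\<close>.  No decay of \<open>u\<close> at infinity is given, so \<open>u\<close> is compared with its
  Kelvin transforms in spheres rather than with its reflections in planes.  Fix a unit vector \<open>e\<close> and
  consider the sphere of radius \<open>t\<close> about \<open>t e\<close>, which passes through the origin.  After rescaling it to the
  unit sphere, let \<open>V\<^sub>t(z) = u (t (e + z))\<close>, and let \<open>gap t\<close> be the Kelvin transform of \<open>V\<^sub>t\<close> minus \<open>V\<^sub>t\<close>.
  The claim is \<open>gap t \<ge> 0\<close> on the punctured unit ball for every \<open>t\<close>.  Because the sphere contains the
  origin and \<open>(n - 2) p \<le> n\<close>, the transform solves an equation with a larger coefficient, so \<open>gap t\<close> is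
  superharmonic wherever it is nonnegative (\<open>gap_superharmonic\<close>).  The set of parameters for which the
  claim holds
  \<^item> contains \<open>0\<close>, where \<open>V\<^sub>0\<close> is constant;
  \<^item> is closed, by continuity;
  \<^item> is open (\<open>good_eventually\<close>): a nonnegative gap is positive inside, its outward normal derivative on the
    sphere is negative, and near the centre the Kelvin transform is controlled by its values on a small
    sphere, as for a superharmonic function with a removable singularity.

  By connectedness the claim holds for all \<open>t\<close>.  As \<open>t\<close> tends to infinity the inversions become the
  reflection in the hyperplane orthogonal to \<open>e\<close>, which gives \<open>u y \<le> u y'\<close> for \<open>y \<bullet> e > 0\<close> and the mirror image
  \<open>y'\<close> of \<open>y\<close> (\<open>le_reflection\<close>).  Any two points of equal norm are mirror images of each other, and exchanging
  them gives the reverse inequality.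
\<close>

section \<open>Second-order calculus and the minimum principle\<close>

text \<open>The Laplacian is the trace of the derivative of a gradient field.  Carrying the gradient \<open>g\<close>
  and the Hessian \<open>H\<close> as data, in place of iterated partial derivatives, makes the chain rule and the
  Kelvin transform free of coordinates.\<close>

definition hessian_trace :: "('a::euclidean_space \<Rightarrow> 'a) \<Rightarrow> real"
  where "hessian_trace H = (\<Sum>b\<in>Basis. H b \<bullet> b)"

definition has_hessian ::
    "('a::euclidean_space \<Rightarrow> real) \<Rightarrow> ('a \<Rightarrow> 'a) \<Rightarrow> ('a \<Rightarrow> 'a) \<Rightarrow> 'a \<Rightarrow> bool"
  where "has_hessian f g H x \<longleftrightarrow>
    (\<forall>\<^sub>F y in nhds x. (f has_derivative (\<lambda>h. g y \<bullet> h)) (at y)) \<and> (g has_derivative H) (at x)"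

definition has_laplacian :: "('a::euclidean_space \<Rightarrow> real) \<Rightarrow> real \<Rightarrow> 'a \<Rightarrow> bool"
  where "has_laplacian f L x \<longleftrightarrow> (\<exists>g H. has_hessian f g H x \<and> hessian_trace H = L)"

lemma has_laplacianI: "has_hessian f g H x \<Longrightarrow> hessian_trace H = L \<Longrightarrow> has_laplacian f L x"
  unfolding has_laplacian_def by blast

lemma hessian_trace_add: "hessian_trace (\<lambda>h. F h + G h) = hessian_trace F + hessian_trace G"
  by (simp add: hessian_trace_def inner_add_left sum.distrib)

lemma hessian_trace_scaleR: "hessian_trace (\<lambda>h. c *\<^sub>R F h) = c * hessian_trace F"
  by (simp add: hessian_trace_def sum_distrib_left)

lemma hessian_trace_id: "hessian_trace (\<lambda>h. h::'a::euclidean_space) = DIM('a)"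
  by (simp add: hessian_trace_def)

lemma hessian_trace_zero: "hessian_trace (\<lambda>h. 0::'a::euclidean_space) = 0"
  by (simp add: hessian_trace_def)

lemma hessian_trace_rank_one: 
  assumes "linear \<phi>"
  shows "hessian_trace (\<lambda>h::'a::euclidean_space. \<phi> h *\<^sub>R v) = \<phi> v"
proof -
  have "\<phi> v = \<phi> (\<Sum>b\<in>Basis. (v \<bullet> b) *\<^sub>R b)"
    by (simp add: euclidean_representation)
  also have "\<dots> = (\<Sum>b\<in>Basis. (v \<bullet> b) * \<phi> b)"
    using assms by (simp add: linear_sum linear_scale)
  finally show ?thesis
    by (simp add: hessian_trace_def mult.commute)
qed

lemma has_hessian_add:
  assumes "has_hessian f g H x" "has_hessian f' g' H' x"
  shows "has_hessian (\<lambda>y. f y + f' y) (\<lambda>y. g y + g' y) (\<lambda>h. H h + H' h) x"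
proof -
  have "\<forall>\<^sub>F y in nhds x. ((\<lambda>y. f y + f' y) has_derivative (\<lambda>h. (g y + g' y) \<bullet> h)) (at y)"
    using assms [unfolded has_hessian_def, THEN conjunct1]
    by eventually_elim (auto intro!: derivative_eq_intros simp: inner_add_left)
  then show ?thesis
    using assms unfolding has_hessian_def by (auto intro: has_derivative_add)
qed

lemma has_hessian_cmult:
  assumes "has_hessian f g H x"
  shows "has_hessian (\<lambda>y. c * f y) (\<lambda>y. c *\<^sub>R g y) (\<lambda>h. c *\<^sub>R H h) x"
proof -
  have "\<forall>\<^sub>F y in nhds x. ((\<lambda>y. c * f y) has_derivative (\<lambda>h. (c *\<^sub>R g y) \<bullet> h)) (at y)"
    using assms [unfolded has_hessian_def, THEN conjunct1]
    by eventually_elim (auto intro!: derivative_eq_intros)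
  then show ?thesis
    using assms unfolding has_hessian_def by (blast intro: has_derivative_scaleR_right)
qed

lemma has_hessian_const: "has_hessian (\<lambda>y. c) (\<lambda>y. 0) (\<lambda>h. 0) x"
  by (simp add: has_hessian_def)

lemma has_hessian_norm_squared: "has_hessian (\<lambda>y. (norm y)\<^sup>2) (\<lambda>y. 2 *\<^sub>R y) (\<lambda>h. 2 *\<^sub>R h) x"
  unfolding has_hessian_def dot_square_norm [symmetric]
  by (auto intro!: derivative_eq_intros always_eventually simp: inner_commute)

lemma has_laplacian_add:
  assumes "has_laplacian f L x" "has_laplacian f' L' x"
  shows "has_laplacian (\<lambda>y. f y + f' y) (L + L') x"
  using assms unfolding has_laplacian_def by (metis has_hessian_add hessian_trace_add)

lemma has_laplacian_cmult:
  assumes "has_laplacian f L x"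
  shows "has_laplacian (\<lambda>y. c * f y) (c * L) x"
  using assms unfolding has_laplacian_def by (metis has_hessian_cmult hessian_trace_scaleR)

lemma has_laplacian_const: "has_laplacian (\<lambda>y. c) 0 x"
  using has_hessian_const hessian_trace_zero by (rule has_laplacianI)

lemma has_laplacian_norm_squared:
  "has_laplacian (\<lambda>y::'a::euclidean_space. (norm y)\<^sup>2) (2 * real DIM('a)) x"
  using has_hessian_norm_squared by (rule has_laplacianI) (simp add: hessian_trace_scaleR hessian_trace_id)

lemma has_laplacian_diff:
  assumes "has_laplacian f L x" "has_laplacian f' L' x"
  shows "has_laplacian (\<lambda>y. f y - f' y) (L - L') x"
  using has_laplacian_add [OF assms(1) has_laplacian_cmult [OF assms(2), of "-1"]] by simp

lemma has_hessian_imp_gradient: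
  "has_hessian f g H x \<Longrightarrow> (f has_derivative (\<lambda>h. g x \<bullet> h)) (at x)"
  unfolding has_hessian_def by (auto dest: eventually_nhds_x_imp_x)

lemma has_laplacian_imp_continuous: "has_laplacian f L x \<Longrightarrow> isCont f x"
  unfolding has_laplacian_def by (auto dest!: has_hessian_imp_gradient has_derivative_continuous)

lemma eventually_nhds_isCont:
  assumes "isCont f x" "\<forall>\<^sub>F y in nhds (f x). P y"
  shows "\<forall>\<^sub>F y in nhds x. P (f y)"
  using assms(2) by (rule eventually_compose_filterlim)
    (use assms(1) in \<open>simp add: isCont_def tendsto_at_iff_tendsto_nhds\<close>)

lemma has_hessian_compose:
  assumes f: "has_hessian f g H x"
    and d1: "\<forall>\<^sub>F s in nhds (f x). (\<phi> has_real_derivative \<phi>' s) (at s)"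
    and d2: "(\<phi>' has_real_derivative \<phi>'') (at (f x))"
  shows "has_hessian (\<lambda>y. \<phi> (f y)) (\<lambda>y. \<phi>' (f y) *\<^sub>R g y)
           (\<lambda>h. (\<phi>'' * (g x \<bullet> h)) *\<^sub>R g x + \<phi>' (f x) *\<^sub>R H h) x"
proof -
  have gx: "(f has_derivative (\<lambda>h. g x \<bullet> h)) (at x)"
    using f by (rule has_hessian_imp_gradient)
  then have "isCont f x"
    by (rule has_derivative_continuous)
  then have "\<forall>\<^sub>F y in nhds x. (\<phi> has_real_derivative \<phi>' (f y)) (at (f y))"
    using d1 by (rule eventually_nhds_isCont)
  moreover have "\<forall>\<^sub>F y in nhds x. (f has_derivative (\<lambda>h. g y \<bullet> h)) (at y)"
    using f by (simp add: has_hessian_def)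
  ultimately have "\<forall>\<^sub>F y in nhds x.
      ((\<lambda>y. \<phi> (f y)) has_derivative (\<lambda>h. (\<phi>' (f y) *\<^sub>R g y) \<bullet> h)) (at y)"
  proof eventually_elim
    case (elim y)
    then show ?case
      using has_derivative_compose [OF elim(2), of \<phi> "(*) (\<phi>' (f y))"]
      by (simp add: has_field_derivative_def)
  qed
  moreover have "((\<lambda>y. \<phi>' (f y)) has_derivative (\<lambda>h. \<phi>'' * (g x \<bullet> h))) (at x)"
    using has_derivative_compose [OF gx, of \<phi>' "(*) \<phi>''"] d2
    by (simp add: has_field_derivative_def)
  then have "((\<lambda>y. \<phi>' (f y) *\<^sub>R g y) has_derivative
      (\<lambda>h. (\<phi>'' * (g x \<bullet> h)) *\<^sub>R g x + \<phi>' (f x) *\<^sub>R H h)) (at x)"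
    using f unfolding has_hessian_def by (auto intro!: derivative_eq_intros simp: add.commute)
  ultimately show ?thesis
    by (simp add: has_hessian_def)
qed

text \<open>The Laplacian of the composition is \<open>\<phi>' (f) \<Delta> f + \<phi>'' (f) \<bar>\<nabla> f\<bar>\<^sup>2\<close>, and the concavity of \<open>\<phi>\<close> gives the
  last term a sign.\<close>

lemma has_laplacian_compose:
  assumes f: "has_laplacian f L x"
    and d1: "\<forall>\<^sub>F s in nhds (f x). (\<phi> has_real_derivative \<phi>' s) (at s)"
    and d2: "(\<phi>' has_real_derivative \<phi>'') (at (f x))"
    and "\<phi>'' \<le> 0"
  shows "\<exists>L'. L' \<le> \<phi>' (f x) * L \<and> has_laplacian (\<lambda>y. \<phi> (f y)) L' x"
proof -
  obtain g H where gH: "has_hessian f g H x" "hessian_trace H = L"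
    using f by (auto simp: has_laplacian_def)
  have "hessian_trace (\<lambda>h. (\<phi>'' * (g x \<bullet> h)) *\<^sub>R g x + \<phi>' (f x) *\<^sub>R H h)
      = \<phi>'' * (g x \<bullet> g x) + \<phi>' (f x) * L"
    using gH(2) by (subst hessian_trace_add, subst hessian_trace_rank_one)
      (auto simp: hessian_trace_scaleR intro!: linearI simp: inner_add_right algebra_simps)
  then have "has_laplacian (\<lambda>y. \<phi> (f y)) (\<phi>'' * (g x \<bullet> g x) + \<phi>' (f x) * L) x"
    using has_hessian_compose [OF gH(1) d1 d2] by (rule has_laplacianI[rotated])
  moreover have "\<phi>'' * (g x \<bullet> g x) \<le> 0"
    using assms(4) by (simp add: mult_nonpos_nonneg)
  ultimately show ?thesis
    by (intro exI[of _ "\<phi>'' * (g x \<bullet> g x) + \<phi>' (f x) * L"]) auto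
qed

text \<open>Restricted to a line through a local minimum, a negative second derivative would make the
  function decrease; hence every diagonal entry of the Hessian is nonnegative.\<close>

lemma local_min_imp_laplacian_nonneg:
  fixes x :: "'a::euclidean_space"
  assumes lap: "has_laplacian f L x"
    and min: "\<forall>\<^sub>F y in nhds x. f x \<le> f y"
  shows "0 \<le> L"
proof -
  obtain g H where gH: "has_hessian f g H x" and L: "hessian_trace H = L"
    using lap by (auto simp: has_laplacian_def)
  have "\<forall>\<^sub>F y in nhds x. f x \<le> f y \<and> (f has_derivative (\<lambda>h. g y \<bullet> h)) (at y)"
    using gH min by (auto simp: has_hessian_def intro: eventually_conj)
  then obtain d where d: "d > 0"
    and near: "\<And>y. dist y x < d \<Longrightarrow> f x \<le> f y \<and> (f has_derivative (\<lambda>h. g y \<bullet> h)) (at y)"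
    unfolding eventually_nhds_metric by blast
  have "0 \<le> H b \<bullet> b" if b: "b \<in> Basis" for b
  proof (rule ccontr)
    assume "\<not> 0 \<le> H b \<bullet> b"
    define \<gamma> where "\<gamma> = (\<lambda>s::real. x + s *\<^sub>R b)"
    have D1: "((\<lambda>s. f (\<gamma> s)) has_real_derivative g (\<gamma> s) \<bullet> b) (at s)" if "\<bar>s\<bar> < d" for s
    proof -
      have "dist (\<gamma> s) x < d"
        using that b by (simp add: \<gamma>_def dist_norm)
      then have "(f has_derivative (\<lambda>h. g (\<gamma> s) \<bullet> h)) (at (\<gamma> s))"
        using near by blast
      moreover have "(\<gamma> has_derivative (\<lambda>h. h *\<^sub>R b)) (at s)"
        unfolding \<gamma>_def by (auto intro!: derivative_eq_intros)
      ultimately have "((\<lambda>s. f (\<gamma> s)) has_derivative (\<lambda>h. g (\<gamma> s) \<bullet> (h *\<^sub>R b))) (at s)"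
        using has_derivative_compose by blast
      then show ?thesis
        by (simp add: has_field_derivative_def mult.commute [of _ "g _ \<bullet> b"])
    qed
    have "(g has_derivative H) (at (\<gamma> 0))"
      using gH by (simp add: has_hessian_def \<gamma>_def)
    moreover have "(\<gamma> has_derivative (\<lambda>h. h *\<^sub>R b)) (at 0)"
      unfolding \<gamma>_def by (auto intro!: derivative_eq_intros)
    ultimately have "((\<lambda>s. g (\<gamma> s)) has_derivative (\<lambda>h. H (h *\<^sub>R b))) (at 0)"
      using has_derivative_compose by blast
    then have "((\<lambda>s. g (\<gamma> s) \<bullet> b) has_derivative (\<lambda>h. H (h *\<^sub>R b) \<bullet> b)) (at 0)"
      by (auto intro!: derivative_eq_intros)
    moreover have "linear H"
      using gH by (auto simp: has_hessian_def intro: has_derivative_linear)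
    ultimately have D2: "((\<lambda>s. g (\<gamma> s) \<bullet> b) has_real_derivative H b \<bullet> b) (at 0)"
      by (simp add: has_field_derivative_def linear_scale mult.commute [of _ "H _ \<bullet> b"])
    have "g (\<gamma> 0) \<bullet> b = 0"
    proof (rule DERIV_local_min [OF D1 d])
      show "\<forall>y. \<bar>0 - y\<bar> < d \<longrightarrow> f (\<gamma> 0) \<le> f (\<gamma> y)"
        using near b by (auto simp: \<gamma>_def dist_norm)
    qed (use d in auto)
    with DERIV_neg_dec_right [OF D2] \<open>\<not> 0 \<le> H b \<bullet> b\<close>
    obtain d' where d': "d' > 0" and neg: "\<And>s. 0 < s \<Longrightarrow> s < d' \<Longrightarrow> g (\<gamma> s) \<bullet> b < 0"
      by auto
    define s where "s = min d d' / 2"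
    have s: "0 < s" "s < d" "s < d'"
      using d d' by (auto simp: s_def)
    have "\<exists>z>0. z < s \<and> f (\<gamma> s) - f (\<gamma> 0) = (s - 0) * (g (\<gamma> z) \<bullet> b)"
      by (rule MVT2) (use s D1 in auto)
    then have "f (\<gamma> s) < f (\<gamma> 0)"
      using neg s by (smt (verit) mult_pos_neg)
    moreover have "f (\<gamma> 0) \<le> f (\<gamma> s)"
      using near s b by (simp add: \<gamma>_def dist_norm)
    ultimately show False
      by simp
  qed
  then show ?thesis
    unfolding L [symmetric] hessian_trace_def by (rule sum_nonneg)
qed

text \<open>Subtracting a small multiple of \<open>\<bar>x\<bar>\<^sup>2\<close> makes the Laplacian strictly negative, which rules out
  interior minima.\<close>

lemma superharmonic_min_principle:
  fixes S :: "'a::euclidean_space set"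
  assumes S: "compact S" and cont: "continuous_on S f"
    and super: "\<And>x. x \<in> S \<Longrightarrow> 0 \<le> f x \<or> (x \<in> interior S \<and> (\<exists>L\<le>0. has_laplacian f L x))"
    and "x \<in> S"
  shows "0 \<le> f x"
proof (rule ccontr)
  assume "\<not> 0 \<le> f x"
  obtain M where M: "\<And>y. y \<in> S \<Longrightarrow> norm y \<le> M"
    using compact_imp_bounded [OF S] unfolding bounded_iff by blast
  define \<eta> where "\<eta> = - f x / (M\<^sup>2 + 1)"
  have pos: "M\<^sup>2 + 1 > 0"
    by (simp add: add_nonneg_pos)
  then have \<eta>: "\<eta> > 0" "\<eta> * M\<^sup>2 < - f x"
    using \<open>\<not> 0 \<le> f x\<close> by (auto simp: \<eta>_def field_simps)
  define F where "F = (\<lambda>y. f y - \<eta> * (norm y)\<^sup>2)"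
  have "continuous_on S F"
    unfolding F_def using cont by (intro continuous_intros)
  then obtain z where z: "z \<in> S" "\<And>y. y \<in> S \<Longrightarrow> F z \<le> F y"
    using continuous_attains_inf [OF S] \<open>x \<in> S\<close> by blast
  have "F z \<le> f x"
    using z(2) [OF \<open>x \<in> S\<close>] \<eta>(1) by (smt (verit) F_def mult_nonneg_nonneg zero_le_power2)
  moreover have "\<eta> * (norm z)\<^sup>2 \<le> \<eta> * M\<^sup>2"
    using M [OF z(1)] \<eta>(1) by (intro mult_left_mono power_mono) auto
  ultimately have "f z < 0"
    using \<eta>(2) by (simp add: F_def)
  then obtain L where L: "z \<in> interior S" "L \<le> 0" "has_laplacian f L z"
    using super [OF z(1)] by auto
  have "has_laplacian F (L - \<eta> * (2 * real DIM('a))) z"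
    unfolding F_def
    by (intro has_laplacian_diff has_laplacian_cmult has_laplacian_norm_squared L)
  moreover have "\<forall>\<^sub>F y in nhds z. F z \<le> F y"
    using eventually_nhds_in_open [OF open_interior L(1)]
    by eventually_elim (use z(2) interior_subset in blast)
  ultimately have "0 \<le> L - \<eta> * (2 * real DIM('a))"
    by (rule local_min_imp_laplacian_nonneg)
  then show False
    using L(2) \<eta>(1) by (smt (verit) DIM_positive mult_pos_pos of_nat_0_less_iff)
qed

section \<open>The Kelvin transform\<close>

text \<open>The factor \<open>\<bar>z\<bar>\<^bsup>2 - n\<^esup>\<close> is written as a power of \<open>z \<bullet> z\<close>, which is differentiable without
  square roots, and \<open>kelvin_grad\<close> is the gradient of the transform in terms of the gradient \<open>g\<close> of \<open>V\<close>.\<close>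

definition inversion :: "'a::euclidean_space \<Rightarrow> 'a"
  where "inversion z = inverse (z \<bullet> z) *\<^sub>R z"

definition kelvin :: "('a::euclidean_space \<Rightarrow> real) \<Rightarrow> 'a \<Rightarrow> real"
  where "kelvin V z = (z \<bullet> z) powr (1 - real DIM('a) / 2) * V (inversion z)"

definition kelvin_grad :: "('a::euclidean_space \<Rightarrow> real) \<Rightarrow> ('a \<Rightarrow> 'a) \<Rightarrow> 'a \<Rightarrow> 'a"
  where "kelvin_grad V g z = (z \<bullet> z) powr (- real DIM('a) / 2) *\<^sub>R
    (g (inversion z) - ((real DIM('a) - 2) * V (inversion z) + 2 * (inversion z \<bullet> g (inversion z))) *\<^sub>R z)"

lemma inversion_has_derivative:
  fixes z :: "'a::euclidean_space"
  assumes "z \<noteq> 0"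
  shows "(inversion has_derivative
    (\<lambda>h. inverse (z \<bullet> z) *\<^sub>R h - (2 * (z \<bullet> h) * (inverse (z \<bullet> z))\<^sup>2) *\<^sub>R z)) (at z)"
  unfolding inversion_def using assms
  by (auto intro!: derivative_eq_intros simp: power2_eq_square inner_commute algebra_simps)

lemma kelvin_has_derivative:
  fixes z :: "'a::euclidean_space"
  assumes z: "z \<noteq> 0"
    and V: "(V has_derivative (\<lambda>h. g (inversion z) \<bullet> h)) (at (inversion z))"
  shows "(kelvin V has_derivative (\<lambda>h. kelvin_grad V g z \<bullet> h)) (at z)"
proof -
  let ?N = "z \<bullet> z" and ?n = "real DIM('a)"
  have N: "?N > 0"
    using z by simp
  note VI = has_derivative_compose [OF inversion_has_derivative [OF z] V]
  have "((\<lambda>z. (z \<bullet> z) powr (1 - ?n / 2)) has_derivative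
      (\<lambda>h. ?N powr (1 - ?n / 2) * (2 * (z \<bullet> h) * (1 - ?n / 2) / ?N))) (at z)"
    using N by (auto intro!: derivative_eq_intros simp: inner_commute)
  note D = has_derivative_mult [OF this VI]
  have pw: "?N powr (1 - ?n / 2) = ?N * ?N powr (- ?n / 2)"
    using N by (simp add: powr_mult_base)
  show ?thesis
    unfolding kelvin_def
    apply (rule has_derivative_eq_rhs [OF D])
    apply (rule ext)
    unfolding pw kelvin_grad_def
    using N by (simp add: inversion_def inner_diff_left inner_diff_right inner_add_left field_simps inner_commute power2_eq_square)
qed

lemma isCont_inversion: "z \<noteq> 0 \<Longrightarrow> isCont inversion z"
  using inversion_has_derivative has_derivative_continuous by blast

text \<open>In the trace, the terms that involve \<open>y \<bullet> H y\<close> for the inverted point \<open>y\<close> cancel, and so do those that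
  involve \<open>y \<bullet> g y\<close> and \<open>V y\<close>; this is the reason for the exponent \<open>2 - n\<close>.  Only the trace of \<open>H\<close> is left.\<close>

lemma has_laplacian_kelvin:
  fixes z :: "'a::euclidean_space"
  assumes z: "z \<noteq> 0"
    and V: "has_laplacian V L (inversion z)"
  shows "has_laplacian (kelvin V) ((z \<bullet> z) powr (- 1 - real DIM('a) / 2) * L) z"
proof -
  let ?N = "z \<bullet> z" and ?n = "real DIM('a)" and ?y = "inversion z"
  obtain g H where gH: "has_hessian V g H ?y" and L: "hessian_trace H = L"
    using V by (auto simp: has_laplacian_def)
  have N: "?N > 0"
    using z by simp
  define DI where "DI = (\<lambda>h. inverse ?N *\<^sub>R h - (2 * (z \<bullet> h) * (inverse ?N)\<^sup>2) *\<^sub>R z)"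
  define E where "E = (\<lambda>y. (?n - 2) * V y + 2 * (y \<bullet> g y))"
  define DE where "DE = (\<lambda>k. ?n * (g ?y \<bullet> k) + 2 * (?y \<bullet> H k))"
  have I: "(inversion has_derivative DI) (at z)"
    unfolding DI_def using z by (rule inversion_has_derivative)
  have gV: "(V has_derivative (\<lambda>h. g ?y \<bullet> h)) (at ?y)"
    using gH by (rule has_hessian_imp_gradient)
  have gD: "(g has_derivative H) (at ?y)"
    using gH by (simp add: has_hessian_def)
  then have linH: "linear H"
    by (rule has_derivative_linear)
  have "(E has_derivative DE) (at ?y)"
    unfolding E_def DE_def
    by (rule derivative_eq_intros gV gD refl)+ (simp add: fun_eq_iff algebra_simps inner_commute)
  from has_derivative_compose [OF I this]
  have EI: "((\<lambda>z. E (inversion z)) has_derivative (\<lambda>h. DE (DI h))) (at z)" .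
  from has_derivative_compose [OF I gD]
  have gI: "((\<lambda>z. g (inversion z)) has_derivative (\<lambda>h. H (DI h))) (at z)" .
  have pI: "((\<lambda>z. (z \<bullet> z) powr (- ?n / 2)) has_derivative
      (\<lambda>h. - ?n * (z \<bullet> h) * (?N powr (- ?n / 2) * inverse ?N))) (at z)"
    using N by (auto intro!: derivative_eq_intros simp: inner_commute field_simps)
  define w where "w = g ?y - E ?y *\<^sub>R z"
  define P where "P = ?N powr (- ?n / 2)"
  define HK where "HK = (\<lambda>h. P *\<^sub>R (H (DI h) + (- 1) *\<^sub>R (DE (DI h) *\<^sub>R z) + (- E ?y) *\<^sub>R h)
      + (- ?n * P * inverse ?N) *\<^sub>R ((z \<bullet> h) *\<^sub>R w))"
  have kg: "kelvin_grad V g = (\<lambda>z. (z \<bullet> z) powr (- ?n / 2) *\<^sub>R (g (inversion z) - E (inversion z) *\<^sub>R z))"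
    by (simp add: kelvin_grad_def E_def fun_eq_iff)
  have "(kelvin_grad V g has_derivative HK) (at z)"
    unfolding kg
    by (rule has_derivative_eq_rhs [OF has_derivative_scaleR [OF pI
          has_derivative_diff [OF gI has_derivative_scaleR [OF EI has_derivative_ident]]]])
      (simp add: HK_def P_def w_def fun_eq_iff algebra_simps)
  moreover have "\<forall>\<^sub>F x in nhds z. (kelvin V has_derivative (\<lambda>h. kelvin_grad V g x \<bullet> h)) (at x)"
  proof -
    have "\<forall>\<^sub>F y in nhds ?y. (V has_derivative (\<lambda>h. g y \<bullet> h)) (at y)"
      using gH by (simp add: has_hessian_def)
    then have "\<forall>\<^sub>F x in nhds z. (V has_derivative (\<lambda>h. g (inversion x) \<bullet> h)) (at (inversion x))"
      by (rule eventually_nhds_isCont [OF isCont_inversion [OF z]])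
    moreover have "\<forall>\<^sub>F x in nhds z. x \<noteq> 0"
      using z by (simp add: t1_space_nhds)
    ultimately show ?thesis
      by eventually_elim (auto intro: kelvin_has_derivative)
  qed
  ultimately have hess: "has_hessian (kelvin V) (kelvin_grad V g) HK z"
    by (simp add: has_hessian_def)
  have DIz: "DI z = - ?y"
    using N by (simp add: DI_def inversion_def power2_eq_square flip: scaleR_left_diff_distrib scaleR_minus_left)
  have Hz: "H z = ?N *\<^sub>R H ?y"
    using N by (simp add: inversion_def linear_scale [OF linH])
  have t1: "hessian_trace (\<lambda>h. H (DI h)) = inverse ?N * L - 2 * (?y \<bullet> H ?y)"
  proof -
    have "(\<lambda>h. H (DI h)) = (\<lambda>h. inverse ?N *\<^sub>R H h + (- 2 * inverse ?N) *\<^sub>R ((z \<bullet> h) *\<^sub>R H ?y))"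
      using N by (simp add: fun_eq_iff DI_def linear_diff [OF linH] linear_scale [OF linH] Hz
        power2_eq_square)
    moreover have "hessian_trace (\<lambda>h. (z \<bullet> h) *\<^sub>R H ?y) = z \<bullet> H ?y"
      by (rule hessian_trace_rank_one) (rule bounded_linear.linear [OF bounded_linear_inner_right])
    ultimately show ?thesis
      using L by (simp only: hessian_trace_add hessian_trace_scaleR) (simp add: inversion_def)
  qed
  have linDI: "linear DI"
    using I by (rule has_derivative_linear)
  have "linear (\<lambda>h. DE (DI h))"
    using EI by (rule has_derivative_linear)
  then have t2: "hessian_trace (\<lambda>h. DE (DI h) *\<^sub>R z) = - DE ?y"
    by (simp add: hessian_trace_rank_one DIz)
      (simp add: DE_def linear_neg [OF linH])
  have "hessian_trace (\<lambda>h. (z \<bullet> h) *\<^sub>R w) = z \<bullet> w"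
    by (rule hessian_trace_rank_one) (rule bounded_linear.linear [OF bounded_linear_inner_right])
  also have "\<dots> = ?N * (g ?y \<bullet> ?y) - ?N * E ?y"
    using N by (simp add: w_def inner_diff_right inversion_def inner_commute)
  finally have t3: "hessian_trace (\<lambda>h. (z \<bullet> h) *\<^sub>R w) = ?N * (g ?y \<bullet> ?y) - ?N * E ?y" .
  have "hessian_trace HK = P * (inverse ?N * L)"
    unfolding HK_def hessian_trace_add hessian_trace_scaleR t1 t2 t3 hessian_trace_id
    using N by (simp add: DE_def field_simps inner_commute)
  moreover have "P * inverse ?N = ?N powr (- 1 - ?n / 2)"
    using N powr_add [of ?N "- ?n / 2" "- 1"] by (simp add: P_def powr_minus add.commute)
  ultimately have "hessian_trace HK = ?N powr (- 1 - ?n / 2) * L"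
    by (simp flip: mult.assoc)
  with hess show ?thesis
    by (rule has_laplacianI)
qed

section \<open>Superharmonic functions near an isolated point, and compactness\<close>

text \<open>The Newton potential \<open>\<bar>z\<bar>\<^bsup>2 - n\<^esup>\<close> is the Kelvin transform of a constant, so it is harmonic.\<close>

lemma newton_harmonic:
  fixes z :: "'a::euclidean_space"
  assumes "z \<noteq> 0"
  shows "has_laplacian (\<lambda>z. (z \<bullet> z) powr (1 - real DIM('a) / 2)) 0 z"
  using has_laplacian_kelvin [OF assms has_laplacian_const [of 1]] by (simp add: kelvin_def [abs_def])

lemma interior_annulus:
  assumes "\<sigma> < norm z" "norm z < \<rho>"
  shows "z \<in> interior (cball 0 \<rho> - ball 0 \<sigma>)"
proof -
  have "ball 0 \<rho> - cball 0 \<sigma> \<subseteq> interior (cball 0 \<rho> - ball 0 \<sigma>)"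
    by (rule interior_maximal) (auto intro: open_Diff)
  then show ?thesis
    using assms by auto
qed

text \<open>An isolated point is invisible to nonnegative superharmonic functions: near it an arbitrarily small
  multiple of the Newton potential already exceeds any prescribed bound, and that multiple is then sent to
  zero.\<close>

lemma superharmonic_punctured_ball:
  fixes f :: "'a::euclidean_space \<Rightarrow> real"
  assumes dim: "3 \<le> DIM('a)"
    and nonneg: "\<And>z. 0 < norm z \<Longrightarrow> norm z \<le> \<rho> \<Longrightarrow> 0 \<le> f z"
    and super: "\<And>z. 0 < norm z \<Longrightarrow> norm z < \<rho> \<Longrightarrow> \<exists>L\<le>0. has_laplacian f L z"
    and cont: "continuous_on (cball 0 \<rho> - {0}) f"
    and bdry: "\<And>z. norm z = \<rho> \<Longrightarrow> m \<le> f z"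
    and z: "0 < norm z" "norm z \<le> \<rho>"
  shows "m \<le> f z"
proof -
  define \<kappa> where "\<kappa> = real DIM('a) / 2 - 1"
  define w where "w = (\<lambda>z::'a. (z \<bullet> z) powr (- \<kappa>))"
  have \<kappa>: "\<kappa> > 0"
    using dim by (simp add: \<kappa>_def)
  have w_pos: "w y > 0" if "y \<noteq> 0" for y
    using that by (simp add: w_def)
  have "m \<le> f z + \<eta> * w z" if \<eta>: "\<eta> > 0" for \<eta>
  proof -
    \<comment> \<open>\<open>s\<close> is the squared radius at which \<open>\<eta> * w\<close> takes the value \<open>\<bar>m\<bar> + 1\<close>\<close>
    define s where "s = ((\<bar>m\<bar> + 1) / \<eta>) powr (- 1 / \<kappa>)"
    define \<sigma> where "\<sigma> = min (sqrt s) (norm z)"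
    have s: "s > 0" "s powr (- \<kappa>) = (\<bar>m\<bar> + 1) / \<eta>"
      using \<kappa> \<eta> by (auto simp: s_def powr_powr intro: add_nonneg_pos)
    have \<sigma>: "0 < \<sigma>" "\<sigma> \<le> norm z" "\<sigma> \<le> sqrt s"
      using s(1) z(1) by (auto simp: \<sigma>_def)
    then have \<sigma>_s: "\<sigma>\<^sup>2 \<le> s"
      using power_mono [of \<sigma> "sqrt s" 2] s(1) by simp
    have w_\<sigma>: "\<eta> * w y \<ge> m" if "norm y = \<sigma>" for y
    proof -
      have "s powr (- \<kappa>) \<le> w y"
        unfolding w_def using that \<sigma> \<sigma>_s \<kappa>
        by (intro powr_mono2') (auto simp: dot_square_norm)
      then have "\<bar>m\<bar> + 1 \<le> \<eta> * w y"
        using \<eta> s(2) by (simp add: pos_divide_le_eq mult.commute)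
      then show ?thesis
        by simp
    qed
    have "0 \<le> (f z + \<eta> * w z) - m"
    proof (rule superharmonic_min_principle [where x = z and f = "\<lambda>z. f z + \<eta> * w z - m"])
      show "compact (cball 0 \<rho> - ball 0 \<sigma> :: 'a set)"
        by (intro compact_diff) auto
      show "continuous_on (cball 0 \<rho> - ball 0 \<sigma>) (\<lambda>z. f z + \<eta> * w z - m)"
        unfolding w_def using \<sigma>(1)
        by (intro continuous_intros continuous_on_subset [OF cont]) auto
      show "z \<in> cball 0 \<rho> - ball 0 \<sigma>"
        using z \<sigma> by simp
      show "0 \<le> f y + \<eta> * w y - m \<or> (y \<in> interior (cball 0 \<rho> - ball 0 \<sigma>) \<and>
          (\<exists>L\<le>0. has_laplacian (\<lambda>z. f z + \<eta> * w z - m) L y))"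
        if y: "y \<in> cball 0 \<rho> - ball 0 \<sigma>" for y
      proof -
        have y': "0 < norm y" "norm y \<le> \<rho>" "\<sigma> \<le> norm y"
          using y \<sigma>(1) by auto
        consider "norm y = \<rho>" | "norm y = \<sigma>" | "\<sigma> < norm y" "norm y < \<rho>"
          using y' by linarith
        then show ?thesis
        proof cases
          case 1
          then show ?thesis
            using bdry [of y] mult_pos_pos [OF \<eta> w_pos [of y]] y' by auto
        next
          case 2
          then show ?thesis
            using w_\<sigma> [of y] nonneg [of y] y' by linarith
        next
          case 3
          obtain L where L: "L \<le> 0" "has_laplacian f L y"
            using super y' 3 by blast
          have "has_laplacian w 0 y"
            using newton_harmonic [of y] y' by (simp add: w_def \<kappa>_def)
          then have "has_laplacian (\<lambda>z. f z + \<eta> * w z - m) (L + \<eta> * 0 - 0) y"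
            using L by (intro has_laplacian_add has_laplacian_diff has_laplacian_cmult has_laplacian_const)
          then show ?thesis
            using interior_annulus [OF 3] L(1) by auto
        qed
      qed
    qed
    then show ?thesis
      by simp
  qed
  then have *: "m \<le> f z + \<eta> * w z" if "\<eta> > 0" for \<eta>
    using that by blast
  show ?thesis
  proof (rule field_le_epsilon)
    fix \<epsilon> :: real
    assume "0 < \<epsilon>"
    moreover have "w z > 0"
      using z w_pos by auto
    ultimately show "m \<le> f z + \<epsilon>"
      using * [of "\<epsilon> / w z"] by simp
  qed
qed

lemma eventually_pos_on_compact:
  fixes F :: "'p::topological_space \<times> 'b::topological_space \<Rightarrow> real"
  assumes C: "compact C" and cont: "continuous_on (U \<times> C) F" and q: "q \<in> U"
    and pos: "\<And>c. c \<in> C \<Longrightarrow> 0 < F (q, c)"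
  shows "\<forall>\<^sub>F r in nhds q. r \<in> U \<longrightarrow> (\<forall>c\<in>C. 0 < F (r, c))"
proof (cases "C = {}")
  case False
  have "continuous_on C (\<lambda>c. F (q, c))"
    by (rule continuous_on_compose2 [OF cont]) (auto intro!: continuous_intros q)
  then obtain c where c: "c \<in> C" "\<And>d. d \<in> C \<Longrightarrow> F (q, c) \<le> F (q, d)"
    using continuous_attains_inf [OF C False] by blast
  define m where "m = F (q, c)"
  have m: "m > 0"
    using pos c by (simp add: m_def)
  obtain X where X: "q \<in> X" "open X"
    "\<forall>x\<in>X \<inter> U. \<forall>d\<in>C. dist (F (x, d)) (F (q, d)) \<le> m / 2"
    by (rule continuous_on_prod_compactE [OF cont C q half_gt_zero [OF m]])
  have "0 < F (x, d)" if "x \<in> X" "x \<in> U" "d \<in> C" for x d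
  proof -
    have "dist (F (x, d)) (F (q, d)) \<le> m / 2" "m \<le> F (q, d)"
      using X(3) c(2) that by (auto simp: m_def)
    then show ?thesis
      using m unfolding dist_real_def by linarith
  qed
  then show ?thesis
    using X(1,2) unfolding eventually_nhds by blast
qed auto

section \<open>Moving spheres through the origin\<close>

text \<open>The field \<open>g\<close> is the gradient of the solution \<open>u\<close>.  The upper bound on \<open>p\<close> enters only through the
  comparison of coefficients in \<open>gap_superharmonic\<close>.\<close>

locale matukuma =
  fixes p :: real and u :: "'a::euclidean_space \<Rightarrow> real" and g :: "'a \<Rightarrow> 'a" and e :: 'a
  assumes dim: "3 \<le> DIM('a)"
    and p: "0 \<le> p" "p \<le> real DIM('a) / (real DIM('a) - 2)"
    and pos: "\<And>x. 0 < u x"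
    and grad: "\<And>x. (u has_derivative (\<lambda>h. g x \<bullet> h)) (at x)"
    and lap: "\<And>x. \<exists>H. (g has_derivative H) (at x) \<and>
                hessian_trace H = - (u x powr p / (1 + (norm x)\<^sup>2))"
    and norm_e: "norm e = 1"
begin

text \<open>In the variable \<open>z\<close> the sphere of radius \<open>\<bar>t\<bar>\<close> about \<open>t e\<close> is the unit sphere.  This keeps the
  domain fixed while the sphere moves, and it turns the degenerate sphere of radius \<open>0\<close> into an ordinary
  member of the family, with constant \<open>dil 0\<close>.\<close>

definition dil :: "real \<Rightarrow> 'a \<Rightarrow> real"
  where "dil t z = u (t *\<^sub>R (e + z))"

definition dil_grad :: "real \<Rightarrow> 'a \<Rightarrow> 'a"
  where "dil_grad t z = t *\<^sub>R g (t *\<^sub>R (e + z))"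

definition gap :: "real \<Rightarrow> 'a \<Rightarrow> real"
  where "gap t z = kelvin (dil t) z - dil t z"

definition gap_grad :: "real \<Rightarrow> 'a \<Rightarrow> 'a"
  where "gap_grad t z = kelvin_grad (dil t) (dil_grad t) z - dil_grad t z"

definition good :: "real \<Rightarrow> bool"
  where "good t \<longleftrightarrow> (\<forall>z. 0 < norm z \<and> norm z < 1 \<longrightarrow> 0 \<le> gap t z)"

lemma continuous_u: "continuous_on S u"
  using has_derivative_continuous [OF grad] by (blast intro: continuous_at_imp_continuous_on)

lemma continuous_g: "continuous_on S g"
  using lap has_derivative_continuous by (blast intro: continuous_at_imp_continuous_on)

lemmas [continuous_intros] =
  continuous_on_compose2 [OF continuous_u [of UNIV]] continuous_on_compose2 [OF continuous_g [of UNIV]]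

lemma continuous_inversion [continuous_intros]:
  assumes "continuous_on S f" "\<And>x. x \<in> S \<Longrightarrow> f x \<noteq> 0"
  shows "continuous_on S (\<lambda>x. inversion (f x))"
  unfolding inversion_def using assms by (intro continuous_intros) auto

lemma continuous_dil [continuous_intros]:
  assumes "continuous_on S t" "continuous_on S z"
  shows "continuous_on S (\<lambda>x. dil (t x) (z x))"
  unfolding dil_def by (intro continuous_intros assms) auto

lemma continuous_dil_grad [continuous_intros]:
  assumes "continuous_on S t" "continuous_on S z"
  shows "continuous_on S (\<lambda>x. dil_grad (t x) (z x))"
  unfolding dil_grad_def by (intro continuous_intros assms) auto

lemma continuous_kelvin_dil [continuous_intros]:
  assumes "continuous_on S t" "continuous_on S z" "\<And>x. x \<in> S \<Longrightarrow> z x \<noteq> 0"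
  shows "continuous_on S (\<lambda>x. kelvin (dil (t x)) (z x))"
  unfolding kelvin_def using assms(3) by (intro continuous_intros assms) auto

lemma continuous_gap:
  assumes "continuous_on S t" "continuous_on S z" "\<And>x. x \<in> S \<Longrightarrow> z x \<noteq> 0"
  shows "continuous_on S (\<lambda>x. gap (t x) (z x))"
  unfolding gap_def by (intro continuous_intros assms)

lemma continuous_gap_grad:
  assumes "continuous_on S t" "continuous_on S z" "\<And>x. x \<in> S \<Longrightarrow> z x \<noteq> 0"
  shows "continuous_on S (\<lambda>x. gap_grad (t x) (z x))"
  unfolding gap_grad_def kelvin_grad_def using assms(3) by (intro continuous_intros assms) auto

lemma dil_has_derivative: "(dil t has_derivative (\<lambda>h. dil_grad t z \<bullet> h)) (at z)"
proof -
  have "((\<lambda>z. t *\<^sub>R (e + z)) has_derivative (\<lambda>h. t *\<^sub>R h)) (at z)"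
    by (auto intro!: derivative_eq_intros)
  from has_derivative_compose [OF this grad] show ?thesis
    by (simp add: dil_def [abs_def] dil_grad_def)
qed

lemma dil_laplacian:
  "has_laplacian (dil t) (- (t\<^sup>2 * dil t z powr p / (1 + t\<^sup>2 * (norm (e + z))\<^sup>2))) z"
proof -
  let ?x = "t *\<^sub>R (e + z)"
  obtain H where H: "(g has_derivative H) (at ?x)"
      "hessian_trace H = - (u ?x powr p / (1 + (norm ?x)\<^sup>2))"
    using lap by blast
  have A: "((\<lambda>z. t *\<^sub>R (e + z)) has_derivative (\<lambda>h. t *\<^sub>R h)) (at z)"
    by (auto intro!: derivative_eq_intros)
  have "((\<lambda>z. g (t *\<^sub>R (e + z))) has_derivative (\<lambda>h. H (t *\<^sub>R h))) (at z)"
    using has_derivative_compose [OF A H(1)] .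
  then have "(dil_grad t has_derivative (\<lambda>h. t *\<^sub>R H (t *\<^sub>R h))) (at z)"
    unfolding dil_grad_def [abs_def] by (rule has_derivative_scaleR_right)
  moreover have "(\<lambda>h. t *\<^sub>R H (t *\<^sub>R h)) = (\<lambda>h. t\<^sup>2 *\<^sub>R H h)"
    using H(1) by (simp add: linear_scale [OF has_derivative_linear] power2_eq_square)
  ultimately have "has_hessian (dil t) (dil_grad t) (\<lambda>h. t\<^sup>2 *\<^sub>R H h) z"
    unfolding has_hessian_def by (simp add: dil_has_derivative)
  then show ?thesis
    by (rule has_laplacianI) (simp add: hessian_trace_scaleR H(2) dil_def power_mult_distrib)
qed

lemma gap_has_derivative:
  assumes "z \<noteq> 0"
  shows "(gap t has_derivative (\<lambda>h. gap_grad t z \<bullet> h)) (at z)"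
  using has_derivative_diff [OF
      kelvin_has_derivative [where V = "dil t" and g = "dil_grad t", OF assms dil_has_derivative]
      dil_has_derivative]
  by (simp add: gap_def [abs_def] gap_grad_def inner_diff_left)

lemma dil_pos: "0 < dil t z"
  by (simp add: dil_def pos)

lemma kelvin_dil_pos: "z \<noteq> 0 \<Longrightarrow> 0 < kelvin (dil t) z"
  by (simp add: kelvin_def dil_pos)

lemma kelvin_dil_superharmonic:
  assumes "z \<noteq> 0"
  shows "\<exists>L\<le>0. has_laplacian (kelvin (dil t)) L z"
proof (intro exI conjI)
  show "has_laplacian (kelvin (dil t)) ((z \<bullet> z) powr (- 1 - real DIM('a) / 2) *
      (- (t\<^sup>2 * dil t (inversion z) powr p / (1 + t\<^sup>2 * (norm (e + inversion z))\<^sup>2)))) z"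
    by (rule has_laplacian_kelvin [OF assms dil_laplacian])
qed (simp add: mult_nonneg_nonpos add_nonneg_nonneg)

text \<open>The unit sphere about \<open>e\<close> passes through the origin, so its inversion multiplies distances to the
  origin by \<open>1 / \<bar>z\<bar>\<close>.  The transformed equation therefore has the coefficient
  \<open>\<bar>z\<bar>\<^bsup>(n - 2) p - n\<^esup> t\<^sup>2 / (\<bar>z\<bar>\<^sup>2 + t\<^sup>2 \<bar>e + z\<bar>\<^sup>2)\<close>, and for \<open>t \<noteq> 0\<close> it exceeds the original coefficient
  \<open>t\<^sup>2 / (1 + t\<^sup>2 \<bar>e + z\<bar>\<^sup>2)\<close>, since \<open>\<bar>z\<bar> < 1\<close> and the exponent of \<open>\<bar>z\<bar>\<close> is not positive.\<close>

lemma gap_superharmonic: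
  assumes z: "0 < norm z" "norm z < 1" and nonneg: "0 \<le> gap t z"
  shows "\<exists>L\<le>0. has_laplacian (gap t) L z \<and> (t \<noteq> 0 \<longrightarrow> L < 0)"
proof -
  let ?N = "z \<bullet> z" and ?K = "kelvin (dil t) z" and ?A = "(norm (e + z))\<^sup>2"
  define k where "k = real DIM('a) / 2"
  define D where "D = dil t (inversion z)"
  have N: "0 < ?N" "?N < 1"
    using z by (auto simp: dot_square_norm power_less_one_iff abs_square_less_1)
  have k: "k > 1" and q: "(k - 1) * p - k \<le> 0"
    using dim p by (auto simp: k_def field_simps)
  have D: "D > 0"
    by (simp add: D_def dil_pos)
  have K: "?K = ?N powr (1 - k) * D"
    by (simp add: kelvin_def k_def D_def)
  have "?K powr p = ?N powr ((1 - k) * p) * D powr p"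
    using D by (simp add: K powr_mult powr_powr)
  then have Dp: "D powr p = ?N powr ((k - 1) * p) * ?K powr p"
    using N by (simp add: powr_minus [symmetric] algebra_simps flip: powr_add)
  have "(norm (e + inversion z))\<^sup>2 = ?A / ?N"
    using N norm_e unfolding inversion_def dot_square_norm [symmetric]
    by (simp add: inner_add_left inner_add_right inner_commute field_simps norm_eq_1)
  then have "has_laplacian (kelvin (dil t))
      (?N powr (- 1 - k) * (- (t\<^sup>2 * D powr p / (1 + t\<^sup>2 * (?A / ?N))))) z"
    using has_laplacian_kelvin [OF _ dil_laplacian [of t "inversion z"]] z(1)
    by (simp add: k_def D_def)
  moreover have "?N powr (- 1 - k) * (- (t\<^sup>2 * D powr p / (1 + t\<^sup>2 * (?A / ?N))))
      = - (t\<^sup>2 * (?N powr ((k - 1) * p - k) * ?K powr p / (?N + t\<^sup>2 * ?A)))"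
  proof -
    have "?N powr (- 1 - k) * D powr p = ?N powr ((k - 1) * p - k) * ?K powr p / ?N"
      using N powr_add [of ?N "- 1 - k" "(k - 1) * p"] powr_add [of ?N "(k - 1) * p - k" "- 1"]
      by (simp add: Dp powr_minus divide_inverse algebra_simps)
    moreover have "1 + t\<^sup>2 * (?A / ?N) = (?N + t\<^sup>2 * ?A) / ?N"
      using N by (simp add: field_simps)
    ultimately show ?thesis
      using N by (simp add: field_simps)
  qed
  ultimately have lapK: "has_laplacian (kelvin (dil t))
      (- (t\<^sup>2 * (?N powr ((k - 1) * p - k) * ?K powr p / (?N + t\<^sup>2 * ?A)))) z"
    by simp
  define X Y where "X = ?N powr ((k - 1) * p - k) * ?K powr p / (?N + t\<^sup>2 * ?A)"
    and "Y = dil t z powr p / (1 + t\<^sup>2 * ?A)"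
  have lapgap: "has_laplacian (gap t) (- (t\<^sup>2 * X) - (- (t\<^sup>2 * Y))) z"
    unfolding gap_def [abs_def] X_def Y_def using lapK dil_laplacian [of t z]
    by (intro has_laplacian_diff) auto
  have V: "0 < dil t z" "dil t z \<le> ?K"
    using nonneg by (auto simp: dil_pos gap_def)
  have "0 \<le> t\<^sup>2 * ?A"
    by simp
  then have tA: "0 < 1 + t\<^sup>2 * ?A" "0 < ?N + t\<^sup>2 * ?A"
    using N by linarith+
  have "Y < dil t z powr p / (?N + t\<^sup>2 * ?A)"
    unfolding Y_def using N tA V by (intro divide_strict_left_mono mult_pos_pos) auto
  also have "\<dots> \<le> ?K powr p / (?N + t\<^sup>2 * ?A)"
    using N tA V p by (intro divide_right_mono powr_mono2) auto
  also have "\<dots> \<le> X"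
  proof -
    have "1 \<le> ?N powr ((k - 1) * p - k)"
      using powr_mono2' [of "(k - 1) * p - k" ?N 1] N q by simp
    then have "1 * ?K powr p \<le> ?N powr ((k - 1) * p - k) * ?K powr p"
      by (rule mult_right_mono) simp
    then show ?thesis
      unfolding X_def using N tA by (intro divide_right_mono) auto
  qed
  finally have "Y < X" .
  then have "- (t\<^sup>2 * X) - (- (t\<^sup>2 * Y)) \<le> 0" "t \<noteq> 0 \<longrightarrow> - (t\<^sup>2 * X) - (- (t\<^sup>2 * Y)) < 0"
    by (auto simp: mult_left_mono)
  then show ?thesis
    using lapgap by blast
qed

lemma gap_sphere: "norm z = 1 \<Longrightarrow> gap t z = 0"
  by (simp add: gap_def kelvin_def inversion_def dot_square_norm)

lemma inner_self_half:
  assumes "norm z = 1 / 2"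
  shows "z \<bullet> z = 1 / 4"
  unfolding dot_square_norm assms by (simp add: power2_eq_square)

lemma newton_gt_1:
  fixes z :: 'a
  assumes "0 < norm z" "norm z < 1"
  shows "1 < (z \<bullet> z) powr (1 - real DIM('a) / 2)"
proof -
  have "0 < z \<bullet> z" "z \<bullet> z < 1"
    using assms by (auto simp: dot_square_norm power_less_one_iff abs_square_less_1)
  then show ?thesis
    using powr_less_mono2_neg [of "1 - real DIM('a) / 2" "z \<bullet> z" 1] dim by simp
qed

lemma gap_0:
  assumes "0 < norm z" "norm z < 1"
  shows "0 < gap 0 z"
  using newton_gt_1 [OF assms] pos [of 0] by (simp add: gap_def kelvin_def dil_def)

lemma good_0: "good 0"
  using gap_0 by (auto simp: good_def less_imp_le)

text \<open>For \<open>t \<noteq> 0\<close> the inequality between the two equations is strict, so an interior zero of the gap would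
  be a minimum with negative Laplacian; for \<open>t = 0\<close> the gap is an explicit function.\<close>

lemma gap_pos:
  assumes "good t" and z: "0 < norm z" "norm z < 1"
  shows "0 < gap t z"
proof (cases "t = 0")
  case True
  then show ?thesis
    using gap_0 z by simp
next
  case False
  have nonneg: "0 \<le> gap t y" if "0 < norm y" "norm y < 1" for y
    using assms(1) that by (simp add: good_def)
  show ?thesis
  proof (rule ccontr)
    assume "\<not> 0 < gap t z"
    then have zero: "gap t z = 0"
      using nonneg [OF z] by simp
    obtain L where L: "has_laplacian (gap t) L z" "L < 0"
      using gap_superharmonic [OF z nonneg [OF z]] False by blast
    have "open (ball 0 1 - {0::'a})" "z \<in> ball 0 1 - {0}"
      using z by (auto intro: open_Diff)
    then have "\<forall>\<^sub>F y in nhds z. y \<in> ball 0 1 - {0}"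
      by (rule eventually_nhds_in_open)
    then have "\<forall>\<^sub>F y in nhds z. gap t z \<le> gap t y"
      by eventually_elim (use nonneg zero in auto)
    then show False
      using local_min_imp_laplacian_nonneg [OF L(1)] L(2) by simp
  qed
qed

lemma ray_has_derivative:
  assumes "r *\<^sub>R \<theta> \<noteq> 0"
  shows "((\<lambda>r. gap t (r *\<^sub>R \<theta>)) has_real_derivative gap_grad t (r *\<^sub>R \<theta>) \<bullet> \<theta>) (at r)"
proof -
  have "((\<lambda>r. r *\<^sub>R \<theta>) has_derivative (\<lambda>h. h *\<^sub>R \<theta>)) (at r)"
    by (auto intro!: derivative_eq_intros)
  from has_derivative_compose [OF this gap_has_derivative [OF assms]] show ?thesis
    by (simp add: has_field_derivative_def mult.commute [of _ "gap_grad _ _ \<bullet> _"])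
qed

text \<open>The boundary point lemma of Hopf.  The barrier \<open>\<bar>z\<bar>\<^bsup>2 - n\<^esup> - 1\<close> is harmonic and vanishes on the unit
  sphere with nonzero slope; a small multiple of it lies below the gap on the inner sphere, hence on the
  whole annulus.\<close>

lemma gap_lower_barrier:
  assumes "good t"
  obtains \<epsilon> where "0 < \<epsilon>"
    "\<And>z. 1 / 2 \<le> norm z \<Longrightarrow> norm z \<le> 1 \<Longrightarrow>
       \<epsilon> * ((z \<bullet> z) powr (1 - real DIM('a) / 2) - 1) \<le> gap t z"
proof -
  define w where "w = (\<lambda>z::'a. (z \<bullet> z) powr (1 - real DIM('a) / 2))"
  have w1: "w y = 1" if "norm y = 1" for y
    using that by (simp add: w_def dot_square_norm)
  obtain b :: 'a where b: "b \<in> Basis"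
    using nonempty_Basis by blast
  have cont: "continuous_on (sphere 0 (1 / 2)) (gap t)"
    by (rule continuous_gap [of _ "\<lambda>_. t" "\<lambda>z. z"]) (auto intro: continuous_intros)
  have "b /\<^sub>R 2 \<in> sphere 0 (1 / 2)"
    using b by simp
  then have "sphere 0 (1 / 2) \<noteq> ({}::'a set)"
    by blast
  then obtain c where c: "norm c = 1 / 2" "\<And>y. norm y = 1 / 2 \<Longrightarrow> gap t c \<le> gap t y"
    using continuous_attains_inf [OF compact_sphere _ cont] by (auto simp: dist_norm)
  define W where "W = (1 / 4 :: real) powr (1 - real DIM('a) / 2)"
  have W: "w y = W" if "norm y = 1 / 2" for y
    by (simp add: w_def W_def inner_self_half [OF that])
  have "W > 1"
    using newton_gt_1 [of c] c(1) W [of c] by (simp add: w_def)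
  define \<epsilon> where "\<epsilon> = gap t c / W"
  have gc: "gap t c > 0"
    by (rule gap_pos [OF assms]) (unfold c(1), simp_all)
  have \<epsilon>: "\<epsilon> > 0"
    using gc \<open>W > 1\<close> by (simp add: \<epsilon>_def)
  have \<epsilon>W: "\<epsilon> * (W - 1) \<le> gap t c"
    using gc \<open>W > 1\<close> by (simp add: \<epsilon>_def field_simps)
  have "0 \<le> gap t z - \<epsilon> * (w z - 1)" if z: "1 / 2 \<le> norm z" "norm z \<le> 1" for z
  proof (rule superharmonic_min_principle [where x = z and f = "\<lambda>z. gap t z - \<epsilon> * (w z - 1)"])
    show "compact (cball 0 1 - ball 0 (1 / 2) :: 'a set)"
      by (intro compact_diff) auto
    show "continuous_on (cball 0 1 - ball 0 (1 / 2)) (\<lambda>z. gap t z - \<epsilon> * (w z - 1))"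
      unfolding w_def by (intro continuous_intros continuous_gap) auto
    show "z \<in> cball 0 1 - ball 0 (1 / 2)"
      using z by simp
    show "0 \<le> gap t y - \<epsilon> * (w y - 1) \<or> (y \<in> interior (cball 0 1 - ball 0 (1 / 2)) \<and>
        (\<exists>L\<le>0. has_laplacian (\<lambda>z. gap t z - \<epsilon> * (w z - 1)) L y))"
      if "y \<in> cball 0 1 - ball 0 (1 / 2)" for y
    proof -
      have "norm y \<le> 1" "1 / 2 \<le> norm y"
        using that by auto
      then consider "norm y = 1" | "norm y = 1 / 2" | "1 / 2 < norm y" "norm y < 1"
        by linarith
      then show ?thesis
      proof cases
        case 1
        then show ?thesis
          by (simp add: gap_sphere w1)
      next
        case 2
        then show ?thesis
          using c(2) [of y] \<epsilon>W W [of y] by auto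
      next
        case 3
        then have y: "0 < norm y" "y \<noteq> 0"
          by auto
        obtain L where L: "L \<le> 0" "has_laplacian (gap t) L y"
          using gap_superharmonic [OF y(1) 3(2) less_imp_le [OF gap_pos [OF assms y(1) 3(2)]]] by blast
        have "has_laplacian w 0 y"
          unfolding w_def using y(2) by (rule newton_harmonic)
        then have "has_laplacian (\<lambda>z. gap t z - \<epsilon> * (w z - 1)) (L - \<epsilon> * (0 - 0)) y"
          using L by (intro has_laplacian_diff has_laplacian_cmult has_laplacian_const)
        then show ?thesis
          using interior_annulus [OF 3] L(1) by auto
      qed
    qed
  qed
  then show thesis
    using that [OF \<epsilon>] by (simp add: w_def)
qed

lemma gap_outward_derivative_neg:
  assumes "good t" and \<theta>: "norm \<theta> = 1"
  shows "gap_grad t \<theta> \<bullet> \<theta> < 0"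
proof -
  let ?a = "1 - real DIM('a) / 2"
  obtain \<epsilon> where \<epsilon>: "0 < \<epsilon>" and barrier: "\<And>z. 1 / 2 \<le> norm z \<Longrightarrow> norm z \<le> 1 \<Longrightarrow>
       \<epsilon> * ((z \<bullet> z) powr ?a - 1) \<le> gap t z"
    using gap_lower_barrier [OF assms(1)] by blast
  define f where "f = (\<lambda>r. gap t (r *\<^sub>R \<theta>) - \<epsilon> * ((r\<^sup>2) powr ?a - 1))"
  have D: "(f has_real_derivative gap_grad t \<theta> \<bullet> \<theta> - \<epsilon> * (2 * ?a)) (at 1)"
  proof -
    have "((\<lambda>r. gap t (r *\<^sub>R \<theta>)) has_real_derivative gap_grad t \<theta> \<bullet> \<theta>) (at 1)"
      using ray_has_derivative [of 1 \<theta> t] \<theta> by force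
    moreover have "((\<lambda>r::real. \<epsilon> * ((r\<^sup>2) powr ?a - 1)) has_real_derivative \<epsilon> * (2 * ?a)) (at 1)"
      by (auto intro!: derivative_eq_intros)
    ultimately show ?thesis
      unfolding f_def by (rule DERIV_diff)
  qed
  \<comment> \<open>\<open>f\<close> is nonnegative on \<open>{1 / 2..1}\<close> and vanishes at \<open>1\<close>\<close>
  have "\<not> 0 < gap_grad t \<theta> \<bullet> \<theta> - \<epsilon> * (2 * ?a)"
  proof
    assume "0 < gap_grad t \<theta> \<bullet> \<theta> - \<epsilon> * (2 * ?a)"
    then obtain d where d: "d > 0" "\<And>h. 0 < h \<Longrightarrow> h < d \<Longrightarrow> f (1 - h) < f 1"
      using DERIV_pos_inc_left [OF D] by blast
    define h where "h = min d 1 / 2"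
    have h: "0 < h" "h < d" "h \<le> 1 / 2"
      using d(1) by (auto simp: h_def)
    have "f 1 = 0"
      using \<theta> by (simp add: f_def gap_sphere)
    moreover have "0 \<le> f (1 - h)"
      using barrier [of "(1 - h) *\<^sub>R \<theta>"] h \<theta> by (simp add: f_def dot_square_norm norm_eq_1 power2_eq_square)
    ultimately show False
      using d(2) h by fastforce
  qed
  moreover have "\<epsilon> * (2 * ?a) < 0"
    using \<epsilon> dim by (simp add: mult_pos_neg)
  ultimately show ?thesis
    by linarith
qed

text \<open>Near the centre the gap itself need not be superharmonic for nearby parameters, since it might be
  negative there; the Kelvin transform always is.  So its infimum over a small punctured ball is read off
  from the bounding sphere, where it depends continuously on the parameter.\<close>

lemma near_centre:
  assumes "good t"
  shows "\<exists>\<rho>>0. \<rho> \<le> 1 / 2 \<and> (\<forall>\<^sub>F s in nhds t. \<forall>z. 0 < norm z \<and> norm z \<le> \<rho> \<longrightarrow> 0 \<le> gap s z)"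
proof -
  obtain \<epsilon> where \<epsilon>: "0 < \<epsilon>" and barrier: "\<And>z. 1 / 2 \<le> norm z \<Longrightarrow> norm z \<le> 1 \<Longrightarrow>
       \<epsilon> * ((z \<bullet> z) powr (1 - real DIM('a) / 2) - 1) \<le> gap t z"
    using gap_lower_barrier [OF assms] by blast
  \<comment> \<open>the barrier on the sphere of radius \<open>1 / 2\<close>, a lower bound for the gap in the whole inner ball\<close>
  define \<delta> where "\<delta> = \<epsilon> * ((1 / 4 :: real) powr (1 - real DIM('a) / 2) - 1)"
  have \<delta>: "\<delta> > 0"
    using \<epsilon> powr_less_mono2_neg [of "1 - real DIM('a) / 2" "1 / 4" 1] dim by (simp add: \<delta>_def)
  have gap_\<delta>: "\<delta> \<le> gap t z" if z: "0 < norm z" "norm z \<le> 1 / 2" for z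
  proof (rule superharmonic_punctured_ball [where f = "gap t", OF dim _ _ _ _ z])
    show "0 \<le> gap t y" if "0 < norm y" "norm y \<le> 1 / 2" for y
      using gap_pos [OF assms, of y] that by simp
    show "\<exists>L\<le>0. has_laplacian (gap t) L y" if "0 < norm y" "norm y < 1 / 2" for y
    proof -
      have y: "0 < norm y" "norm y < 1"
        using that by auto
      then show ?thesis
        using gap_superharmonic [OF y less_imp_le [OF gap_pos [OF assms y]]] by blast
    qed
    show "continuous_on (cball 0 (1 / 2) - {0}) (gap t)"
      by (rule continuous_gap [of _ "\<lambda>_. t" "\<lambda>z. z"]) (auto intro: continuous_intros)
    show "\<delta> \<le> gap t y" if "norm y = 1 / 2" for y
      using barrier [of y] that by (simp add: \<delta>_def inner_self_half [OF that])
  qed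
  \<comment> \<open>on a small ball this level separates \<open>dil t\<close> from its Kelvin transform\<close>
  define m where "m = dil t 0 + \<delta> / 2"
  have "isCont (dil t) 0"
    using dil_has_derivative by (rule has_derivative_continuous)
  then obtain \<rho>' where \<rho>': "\<rho>' > 0" "\<And>z. norm z < \<rho>' \<Longrightarrow> \<bar>dil t z - dil t 0\<bar> < \<delta> / 2"
    using half_gt_zero [OF \<delta>] unfolding continuous_at_eps_delta dist_norm diff_zero real_norm_def
    by blast
  define \<rho> where "\<rho> = min (\<rho>' / 2) (1 / 2)"
  have \<rho>: "0 < \<rho>" "\<rho> \<le> 1 / 2" "\<rho> < \<rho>'"
    using \<rho>'(1) by (auto simp: \<rho>_def)
  have dil_lt: "dil t z < m" if "norm z \<le> \<rho>" for z
  proof -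
    have "\<bar>dil t z - dil t 0\<bar> < \<delta> / 2"
      using \<rho>'(2) [of z] \<rho> that by linarith
    then show ?thesis
      unfolding m_def by linarith
  qed
  have kelvin_gt: "m < kelvin (dil t) z" if "norm z = \<rho>" for z
  proof -
    have "\<bar>dil t z - dil t 0\<bar> < \<delta> / 2" "\<delta> \<le> gap t z"
      using \<rho>'(2) [of z] \<rho> gap_\<delta> [of z] that by linarith+
    then show ?thesis
      unfolding m_def gap_def by linarith
  qed
  have "\<forall>\<^sub>F s in nhds t. s \<in> UNIV \<longrightarrow> (\<forall>z\<in>sphere 0 \<rho>. 0 < (\<lambda>(s, z). kelvin (dil s) z - m) (s, z))"
    by (rule eventually_pos_on_compact)
      (use \<rho> kelvin_gt in \<open>auto simp: case_prod_beta intro!: continuous_intros\<close>)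
  moreover
  have "\<forall>\<^sub>F s in nhds t. s \<in> UNIV \<longrightarrow> (\<forall>z\<in>cball 0 \<rho>. 0 < (\<lambda>(s, z). m - dil s z) (s, z))"
    by (rule eventually_pos_on_compact)
      (use \<rho> dil_lt in \<open>auto simp: case_prod_beta intro!: continuous_intros\<close>)
  ultimately have "\<forall>\<^sub>F s in nhds t. \<forall>z. 0 < norm z \<and> norm z \<le> \<rho> \<longrightarrow> 0 \<le> gap s z"
  proof eventually_elim
    case (elim s)
    show ?case
    proof (intro allI impI, elim conjE)
      fix z :: 'a
      assume z: "0 < norm z" "norm z \<le> \<rho>"
      have "m \<le> kelvin (dil s) z"
      proof (rule superharmonic_punctured_ball [where f = "kelvin (dil s)", OF dim _ _ _ _ z])
        show "0 \<le> kelvin (dil s) y" if "0 < norm y" "norm y \<le> \<rho>" for y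
          using kelvin_dil_pos [of y s] that by simp
        show "\<exists>L\<le>0. has_laplacian (kelvin (dil s)) L y" if "0 < norm y" "norm y < \<rho>" for y
          using kelvin_dil_superharmonic that by simp
        show "continuous_on (cball 0 \<rho> - {0}) (kelvin (dil s))"
          by (rule continuous_kelvin_dil [of _ "\<lambda>_. s" "\<lambda>z. z"]) (auto intro: continuous_intros)
        show "m \<le> kelvin (dil s) y" if "norm y = \<rho>" for y
          using elim(1) that by (simp add: less_imp_le)
      qed
      moreover have "dil s z \<le> m"
        using elim(2) z by (simp add: less_imp_le)
      ultimately show "0 \<le> gap s z"
        by (simp add: gap_def)
    qed
  qed
  then show ?thesis
    using \<rho> by blast
qed

text \<open>The negative outward derivative persists on a collar of the sphere for nearby parameters, and the
  gap vanishes on the sphere for every parameter.\<close>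

lemma near_sphere:
  assumes "good t"
  shows "\<exists>\<sigma><1. \<forall>\<^sub>F s in nhds t. \<forall>z. \<sigma> \<le> norm z \<and> norm z < 1 \<longrightarrow> 0 \<le> gap s z"
proof -
  have "\<forall>\<^sub>F q in nhds (t, 1). q \<in> UNIV \<times> {1 / 2..} \<longrightarrow>
      (\<forall>\<theta>\<in>sphere 0 1. 0 < (\<lambda>((s, r), \<theta>). - (gap_grad s (r *\<^sub>R \<theta>) \<bullet> \<theta>)) (q, \<theta>))"
    by (rule eventually_pos_on_compact)
      (use gap_outward_derivative_neg [OF assms]
        in \<open>auto simp: case_prod_beta intro!: continuous_intros continuous_gap_grad\<close>)
  then obtain P Q where P: "eventually P (nhds t)" and Q: "eventually Q (nhds (1::real))"
    and PQ: "\<And>s r \<theta>. P s \<Longrightarrow> Q r \<Longrightarrow> 1 / 2 \<le> r \<Longrightarrow> norm \<theta> = 1 \<Longrightarrow> gap_grad s (r *\<^sub>R \<theta>) \<bullet> \<theta> < 0"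
    unfolding nhds_prod eventually_prod_filter by (auto 4 4)
  obtain d where d: "d > 0" "\<And>r. \<bar>r - 1\<bar> < d \<Longrightarrow> Q r"
    using Q unfolding eventually_nhds_metric by (auto simp: dist_real_def)
  define \<sigma> where "\<sigma> = max (1 / 2) (1 - d / 2)"
  have \<sigma>: "\<sigma> < 1" "1 / 2 \<le> \<sigma>" "1 - d < \<sigma>"
    using d(1) by (auto simp: \<sigma>_def)
  have "0 \<le> gap s z" if s: "P s" and z: "\<sigma> \<le> norm z" "norm z < 1" for s z
  proof -
    define \<theta> where "\<theta> = z /\<^sub>R norm z"
    have "z \<noteq> 0"
      using z \<sigma> by auto
    then have \<theta>: "norm \<theta> = 1" "norm z *\<^sub>R \<theta> = z" "\<theta> \<noteq> 0"
      by (auto simp: \<theta>_def)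
    have "\<exists>r>norm z. r < 1 \<and>
        gap s (1 *\<^sub>R \<theta>) - gap s (norm z *\<^sub>R \<theta>) = (1 - norm z) * (gap_grad s (r *\<^sub>R \<theta>) \<bullet> \<theta>)"
      using z \<sigma> \<theta> by (intro MVT2 ray_has_derivative) auto
    then obtain r where r: "norm z < r" "r < 1"
        "gap s \<theta> - gap s z = (1 - norm z) * (gap_grad s (r *\<^sub>R \<theta>) \<bullet> \<theta>)"
      using \<theta>(2) by auto
    have "gap_grad s (r *\<^sub>R \<theta>) \<bullet> \<theta> < 0"
      using r z \<sigma> d(2) by (intro PQ s \<theta>) auto
    then have "(1 - norm z) * (gap_grad s (r *\<^sub>R \<theta>) \<bullet> \<theta>) < 0"
      using z by (simp add: mult_pos_neg)
    then show ?thesis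
      using r(3) gap_sphere [OF \<theta>(1)] by simp
  qed
  then have "\<forall>\<^sub>F s in nhds t. \<forall>z. \<sigma> \<le> norm z \<and> norm z < 1 \<longrightarrow> 0 \<le> gap s z"
    using P by (auto elim: eventually_mono)
  then show ?thesis
    using \<sigma>(1) by blast
qed

lemma good_eventually:
  assumes "good t"
  shows "\<forall>\<^sub>F s in nhds t. good s"
proof -
  obtain \<rho> where \<rho>: "\<rho> > 0"
    and centre: "\<forall>\<^sub>F s in nhds t. \<forall>z. 0 < norm z \<and> norm z \<le> \<rho> \<longrightarrow> 0 \<le> gap s z"
    using near_centre [OF assms] by blast
  obtain \<sigma> where \<sigma>: "\<sigma> < 1"
    and sphere: "\<forall>\<^sub>F s in nhds t. \<forall>z. \<sigma> \<le> norm z \<and> norm z < 1 \<longrightarrow> 0 \<le> gap s z"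
    using near_sphere [OF assms] by blast
  have "compact (cball 0 \<sigma> - ball 0 \<rho> :: 'a set)"
    by (intro compact_diff) auto
  then have "\<forall>\<^sub>F s in nhds t. s \<in> UNIV \<longrightarrow>
      (\<forall>z\<in>cball 0 \<sigma> - ball 0 \<rho>. 0 < (\<lambda>(s, z). gap s z) (s, z))"
    by (rule eventually_pos_on_compact)
      (use \<rho> \<sigma> in \<open>auto simp: case_prod_beta intro!: continuous_intros continuous_gap gap_pos [OF assms]\<close>)
  with centre sphere show ?thesis
  proof eventually_elim
    case (elim s)
    show ?case
      unfolding good_def
    proof (intro allI impI, elim conjE)
      fix z :: 'a
      assume "0 < norm z" "norm z < 1"
      then consider "norm z \<le> \<rho>" | "\<sigma> \<le> norm z" | "z \<in> cball 0 \<sigma> - ball 0 \<rho>"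
        by fastforce
      then show "0 \<le> gap s z"
        using elim \<open>0 < norm z\<close> \<open>norm z < 1\<close> by cases (auto simp: less_imp_le)
    qed
  qed
qed

lemma all_good: "good t"
proof -
  have "open (Collect good)"
  proof (subst open_subopen, intro ballI)
    fix t
    assume "t \<in> Collect good"
    then obtain S where "open S" "t \<in> S" "\<forall>s\<in>S. good s"
      using good_eventually [of t] by (auto simp: eventually_nhds)
    then show "\<exists>T. open T \<and> t \<in> T \<and> T \<subseteq> Collect good"
      by (intro exI [of _ S]) auto
  qed
  moreover have "closed (Collect good)"
  proof -
    have "Collect good = (\<Inter>z\<in>{z. 0 < norm z \<and> norm z < 1}. {t. 0 \<le> gap t z})"
      by (auto simp: good_def)
    moreover have "closed {t. 0 \<le> gap t z}" if "0 < norm z" for z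
      using that by (intro closed_Collect_le continuous_intros continuous_gap) auto
    ultimately show ?thesis
      by auto
  qed
  ultimately have "Collect good = {} \<or> Collect good = UNIV"
    using connected_UNIV [where 'a = real] unfolding connected_clopen by auto
  then show ?thesis
    using good_0 by auto
qed

text \<open>As \<open>t\<close> grows, the spheres of radius \<open>t\<close> about \<open>t e\<close> flatten to the hyperplane orthogonal to \<open>e\<close>, and the
  inversions in them tend to the reflection in that hyperplane.\<close>

lemma le_reflection:
  assumes y: "0 < y \<bullet> e"
  shows "u y \<le> u (y - (2 * (y \<bullet> e)) *\<^sub>R e)"
proof -
  \<comment> \<open>the point with \<open>t (e + z t) = y\<close>; it lies in the unit ball for large \<open>t\<close> because \<open>y \<bullet> e > 0\<close>\<close>
  define z where "z = (\<lambda>t. y /\<^sub>R t - e)"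
  define N where "N = (\<lambda>t. z t \<bullet> z t)"
  have N: "N t = 1 - (2 * (y \<bullet> e)) / t + (y \<bullet> y) / t\<^sup>2" for t
    using norm_e by (simp add: N_def z_def inner_diff_left inner_diff_right inner_commute
        norm_eq_1 power2_eq_square divide_inverse algebra_simps)
  have inv0: "((\<lambda>t. c / t) \<longlongrightarrow> 0) at_top" for c :: real
    by (rule tendsto_divide_0 [OF tendsto_const filterlim_at_top_imp_at_infinity [OF filterlim_ident]])
  have "((\<lambda>t. 1 - (2 * (y \<bullet> e)) / t + (y \<bullet> y) * (1 / t) * (1 / t)) \<longlongrightarrow> 1 - 0 + (y \<bullet> y) * 0 * 0) at_top"
    by (intro tendsto_intros inv0)
  moreover have "N = (\<lambda>t. 1 - (2 * (y \<bullet> e)) / t + (y \<bullet> y) * (1 / t) * (1 / t))"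
    by (simp add: N fun_eq_iff power2_eq_square)
  ultimately have N_lim: "(N \<longlongrightarrow> 1) at_top"
    by simp
  have "((\<lambda>t. (y \<bullet> y) / t - 2 * (y \<bullet> e)) \<longlongrightarrow> 0 - 2 * (y \<bullet> e)) at_top"
    by (intro tendsto_intros inv0)
  moreover have "\<forall>\<^sub>F t in at_top. (y \<bullet> y) / t - 2 * (y \<bullet> e) = t * (N t - 1)"
    using eventually_gt_at_top [of 0] by eventually_elim (simp add: N field_simps power2_eq_square)
  ultimately have tN_lim: "((\<lambda>t. t * (N t - 1)) \<longlongrightarrow> - (2 * (y \<bullet> e))) at_top"
    by (auto dest: tendsto_cong)
  have "((\<lambda>t. N t powr (1 - real DIM('a) / 2) * u (inverse (N t) *\<^sub>R (y + (t * (N t - 1)) *\<^sub>R e)))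
      \<longlongrightarrow> 1 powr (1 - real DIM('a) / 2) * u (inverse 1 *\<^sub>R (y + (- (2 * (y \<bullet> e))) *\<^sub>R e))) at_top"
    using has_derivative_continuous [OF grad]
    by (intro tendsto_mult tendsto_powr N_lim isCont_tendsto_compose [of _ u] tendsto_scaleR tendsto_add
        tendsto_inverse tN_lim tendsto_const) auto
  moreover have "\<forall>\<^sub>F t in at_top.
      u y \<le> N t powr (1 - real DIM('a) / 2) * u (inverse (N t) *\<^sub>R (y + (t * (N t - 1)) *\<^sub>R e))"
  proof -
    have "\<forall>\<^sub>F t in at_top. t * (N t - 1) < 0"
      using tN_lim y by (intro order_tendstoD(2)) auto
    moreover have "\<forall>\<^sub>F t in at_top. 0 < N t"
      using N_lim by (intro order_tendstoD(1)) auto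
    ultimately show ?thesis
      using eventually_gt_at_top [of "0::real"]
    proof eventually_elim
      case (elim t)
      then have "N t < 1"
        by (simp add: mult_less_0_iff)
      then have "0 < norm (z t)" "norm (z t) < 1"
        using elim(2) by (auto simp: N_def norm_eq_sqrt_inner)
      then have "dil t (z t) \<le> kelvin (dil t) (z t)"
        using all_good [of t] by (simp add: good_def gap_def)
      moreover have "dil t (z t) = u y"
        using elim(3) by (simp add: dil_def z_def)
      moreover have "t *\<^sub>R (e + inversion (z t)) = inverse (N t) *\<^sub>R (y + (t * (N t - 1)) *\<^sub>R e)"
      proof -
        have "t *\<^sub>R z t = y - t *\<^sub>R e"
          using elim(3) by (simp add: z_def scaleR_diff_right)
        then have "y + (t * (N t - 1)) *\<^sub>R e = t *\<^sub>R z t + (N t * t) *\<^sub>R e"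
          by (simp add: algebra_simps)
        moreover have "inversion (z t) = inverse (N t) *\<^sub>R z t"
          by (simp add: inversion_def N_def)
        ultimately show ?thesis
          using elim(2) by (simp add: scaleR_add_right mult.commute add.commute)
      qed
      ultimately show ?case
        by (simp add: kelvin_def dil_def N_def)
    qed
  qed
  ultimately have "u y \<le> 1 powr (1 - real DIM('a) / 2) * u (inverse 1 *\<^sub>R (y + (- (2 * (y \<bullet> e))) *\<^sub>R e))"
    by (rule tendsto_lowerbound) simp
  then show ?thesis
    by simp
qed

end

section \<open>Radial symmetry and nonexistence\<close>

text \<open>For \<open>e\<close> along \<open>x - y\<close> the reflection exchanges \<open>x\<close> and \<open>y\<close>, and \<open>x\<close> lies on the positive side.\<close>

lemma equal_norm_imp_le:
  fixes u :: "'a::euclidean_space \<Rightarrow> real"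
  assumes sol: "\<And>e. norm e = 1 \<Longrightarrow> matukuma p u g e" and "norm x = norm y"
  shows "u x \<le> u y"
proof (cases "x = y")
  case False
  define e where "e = (x - y) /\<^sub>R norm (x - y)"
  have d: "norm (x - y) > 0"
    using False by simp
  have "2 * (x \<bullet> (x - y)) = (norm (x - y))\<^sup>2"
    unfolding dot_square_norm [symmetric]
    using assms(2) by (simp add: norm_eq inner_diff_left inner_diff_right inner_commute)
  then have "inverse (norm (x - y)) * (2 * (x \<bullet> (x - y))) = norm (x - y)"
    using d by (simp add: power2_eq_square)
  then have xe: "2 * (x \<bullet> e) = norm (x - y)"
    unfolding e_def inner_scaleR_right by (simp only: mult.left_commute)
  interpret matukuma p u g e
    using sol d by (simp add: e_def)
  have "u x \<le> u (x - (2 * (x \<bullet> e)) *\<^sub>R e)"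
    using xe d by (intro le_reflection) linarith
  also have "x - (2 * (x \<bullet> e)) *\<^sub>R e = y"
    unfolding xe using d by (simp add: e_def)
  finally show ?thesis .
qed simp

text \<open>The concave power \<open>u\<^bsup>1 - p\<^esup> / (1 - p)\<close> satisfies a linear inequality, whose right-hand side is the
  decay rate of the Laplacian of \<open>ln (1 + \<bar>x\<bar>\<^sup>2)\<close>.  A small multiple of that logarithm may therefore be
  added at no cost, and it forces an interior minimum of a strictly superharmonic function.\<close>

lemma no_positive_sublinear_solution:
  fixes u :: "'a::euclidean_space \<Rightarrow> real"
  assumes p: "0 \<le> p" "p < 1" and pos: "\<And>x. 0 < u x"
    and lap: "\<And>x. has_laplacian u (- (u x powr p / (1 + (norm x)\<^sup>2))) x"
  shows False
proof -
  define c where "c = 1 / (4 * real DIM('a))"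
  have c: "c > 0" and cn: "c * (2 * real DIM('a)) = 1 / 2"
    by (simp_all add: c_def)
  define w where "w = (\<lambda>x. u x powr (1 - p) / (1 - p))"
  define v where "v = (\<lambda>x::'a. ln (1 + (norm x)\<^sup>2))"
  define F where "F = (\<lambda>x. w x + c * v x)"
  have r: "0 < 1 + (norm x)\<^sup>2" for x :: 'a
    by (simp add: add_pos_nonneg)
  have w_pos: "0 < w x" for x
    using p pos [of x] by (simp add: w_def)
  have lap_w: "\<exists>L. L \<le> - 1 / (1 + (norm x)\<^sup>2) \<and> has_laplacian w L x" for x
  proof -
    have "\<exists>L. L \<le> u x powr (- p) * (- (u x powr p / (1 + (norm x)\<^sup>2))) \<and>
        has_laplacian (\<lambda>y. u y powr (1 - p) / (1 - p)) L x"
    proof (rule has_laplacian_compose [OF lap])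
      have "((\<lambda>s. s powr (1 - p) / (1 - p)) has_real_derivative s powr (- p)) (at s)" if "0 < s" for s
        using that p by (auto intro!: derivative_eq_intros)
      then show "\<forall>\<^sub>F s in nhds (u x).
          ((\<lambda>s. s powr (1 - p) / (1 - p)) has_real_derivative s powr (- p)) (at s)"
        using eventually_nhds_in_open [OF open_greaterThan, of "u x" 0] pos [of x]
        by (auto elim: eventually_mono)
      show "((\<lambda>s. s powr (- p)) has_real_derivative - p * u x powr (- p - 1)) (at (u x))"
        using pos [of x] by (auto intro!: derivative_eq_intros)
      show "- p * u x powr (- p - 1) \<le> 0"
        using p by simp
    qed
    moreover have "u x powr (- p) * (- (u x powr p / (1 + (norm x)\<^sup>2))) = - 1 / (1 + (norm x)\<^sup>2)"
      using pos [of x] less_imp_neq [OF pos [of x]] by (simp add: powr_minus)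
    ultimately show ?thesis
      by (simp only: w_def)
  qed
  have lap_v: "\<exists>L. L \<le> 2 * real DIM('a) / (1 + (norm x)\<^sup>2) \<and> has_laplacian v L x" for x :: 'a
  proof -
    have "\<exists>L. L \<le> inverse (1 + (norm x)\<^sup>2) * (0 + 2 * real DIM('a)) \<and>
        has_laplacian (\<lambda>y. ln (1 + (norm y)\<^sup>2)) L x"
    proof (rule has_laplacian_compose [OF has_laplacian_add [OF has_laplacian_const has_laplacian_norm_squared]])
      have "(ln has_real_derivative inverse s) (at s)" if "0 < s" for s :: real
        using that by (auto intro!: derivative_eq_intros simp: divide_inverse)
      then show "\<forall>\<^sub>F s in nhds (1 + (norm x)\<^sup>2). (ln has_real_derivative inverse s) (at s)"
        using eventually_nhds_in_open [OF open_greaterThan, of "1 + (norm x)\<^sup>2" 0] r [of x]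
        by (auto elim: eventually_mono)
      show "(inverse has_real_derivative - (inverse (1 + (norm x)\<^sup>2))\<^sup>2) (at (1 + (norm x)\<^sup>2))"
        using r [of x] by (auto intro!: derivative_eq_intros simp: power2_eq_square)
    qed simp
    then show ?thesis
      by (simp add: v_def divide_inverse mult.commute)
  qed
  have lap_F: "\<exists>L<0. has_laplacian F L x" for x
  proof -
    obtain Lw Lv where L: "Lw \<le> - 1 / (1 + (norm x)\<^sup>2)" "has_laplacian w Lw x"
        "Lv \<le> 2 * real DIM('a) / (1 + (norm x)\<^sup>2)" "has_laplacian v Lv x"
      using lap_w lap_v by blast
    have "c * Lv \<le> c * (2 * real DIM('a) / (1 + (norm x)\<^sup>2))"
      using L(3) c by (intro mult_left_mono) auto
    also have "\<dots> = 1 / 2 / (1 + (norm x)\<^sup>2)"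
      by (simp flip: cn)
    finally have "Lw + c * Lv \<le> - 1 / (1 + (norm x)\<^sup>2) + 1 / 2 / (1 + (norm x)\<^sup>2)"
      using L(1) by (rule add_mono[rotated])
    also have "\<dots> = - (1 / 2) / (1 + (norm x)\<^sup>2)"
      by (subst add_divide_distrib [symmetric]) simp
    also have "\<dots> < 0"
      using r [of x] by (simp add: divide_neg_pos)
    finally show ?thesis
      unfolding F_def
      by (intro exI [of _ "Lw + c * Lv"] conjI has_laplacian_add has_laplacian_cmult L)
  qed
  \<comment> \<open>outside this radius the logarithmic term alone exceeds \<open>F 0\<close>\<close>
  define R where "R = sqrt (exp (F 0 / c))"
  have R: "R > 0" "R\<^sup>2 = exp (F 0 / c)"
    by (simp_all add: R_def)
  have "continuous_on (cball 0 R) F"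
    using lap_F has_laplacian_imp_continuous by (blast intro: continuous_at_imp_continuous_on)
  moreover have "0 \<in> cball (0::'a) R"
    using R by simp
  ultimately obtain z where z: "z \<in> cball 0 R" "\<And>y. y \<in> cball 0 R \<Longrightarrow> F z \<le> F y"
    using continuous_attains_inf [OF compact_cball] by (metis empty_iff)
  have "norm z \<noteq> R"
  proof
    assume "norm z = R"
    have "ln (R\<^sup>2) < ln (1 + R\<^sup>2)"
      using R(1) by (subst ln_less_cancel_iff) (simp_all add: add_pos_pos)
    then have "F 0 / c < ln (1 + R\<^sup>2)"
      unfolding R(2) ln_exp .
    then have "F 0 < c * v z"
      using c \<open>norm z = R\<close> by (simp add: v_def field_simps)
    also have "\<dots> < F z"
      using w_pos [of z] by (simp add: F_def)
    also have "F z \<le> F 0"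
      using z(2) R by simp
    finally show False
      by simp
  qed
  then have "z \<in> ball 0 R"
    using z(1) by simp
  then have "\<forall>\<^sub>F y in nhds z. y \<in> ball 0 R"
    by (intro eventually_nhds_in_open) auto
  then have "\<forall>\<^sub>F y in nhds z. F z \<le> F y"
    by eventually_elim (use z(2) in auto)
  moreover obtain L where "L < 0" "has_laplacian F L z"
    using lap_F by blast
  ultimately show False
    using local_min_imp_laplacian_nonneg by fastforce
qed

lemma C2_gradient_hessian:
  fixes u :: "real ^ 'n::finite \<Rightarrow> real"
  assumes "Ck 2 u"
  defines "g \<equiv> \<lambda>x. \<chi> i. partial_deriv i u x"
  shows "(u has_derivative (\<lambda>h. g x \<bullet> h)) (at x)"
    and "\<exists>H. (g has_derivative H) (at x) \<and> hessian_trace H = laplacian u x"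
proof -
  have d: "u differentiable at y" "partial_deriv i u differentiable at y" for i y
    using assms(1) by (auto simp: numeral_2_eq_2 differentiable_on_def)
  define u' where "u' = frechet_derivative u (at x)"
  have u': "(u has_derivative u') (at x)"
    unfolding u'_def using d(1) by (simp add: frechet_derivative_works)
  then have "linear u'"
    by (rule has_derivative_linear)
  have "u' h = g x \<bullet> h" for h
  proof -
    have "u' h = u' (\<Sum>i\<in>UNIV. h $ i *\<^sub>R axis i 1)"
      using basis_expansion [of h] by (simp add: scalar_mult_eq_scaleR)
    also have "\<dots> = (\<Sum>i\<in>UNIV. h $ i * u' (axis i 1))"
      using \<open>linear u'\<close> by (simp add: linear_sum linear_scale)
    finally show ?thesis
      by (simp add: g_def inner_vec_def partial_deriv_def u'_def mult.commute)
  qed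
  then have "u' = (\<lambda>h. g x \<bullet> h)"
    by (rule ext)
  with u' show "(u has_derivative (\<lambda>h. g x \<bullet> h)) (at x)"
    by simp
  define H where "H = (\<lambda>h. \<chi> i. frechet_derivative (partial_deriv i u) (at x) h)"
  have "(g has_derivative H) (at x)"
    unfolding has_derivative_componentwise_within [of g]
  proof
    fix b :: "real ^ 'n"
    assume "b \<in> Basis"
    then obtain i where b: "b = axis i 1"
      by (auto simp: Basis_vec_def)
    show "((\<lambda>x. g x \<bullet> b) has_derivative (\<lambda>h. H h \<bullet> b)) (at x)"
      using d(2) [of i x] by (simp add: b g_def H_def inner_axis frechet_derivative_works)
  qed
  moreover have "hessian_trace H = laplacian u x"
  proof -
    have Basis: "Basis = range (\<lambda>i. axis i 1 :: real ^ 'n)"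
      by (auto simp: Basis_vec_def)
    have inj: "inj (\<lambda>i. axis i 1 :: real ^ 'n)"
      by (simp add: inj_on_def axis_eq_axis)
    have "hessian_trace H = (\<Sum>i\<in>UNIV. H (axis i 1) \<bullet> axis i 1)"
      unfolding hessian_trace_def Basis sum.reindex [OF inj] by simp
    then show ?thesis
      by (simp add: H_def laplacian_def partial_deriv_def inner_axis)
  qed
  ultimately show "\<exists>H. (g has_derivative H) (at x) \<and> hessian_trace H = laplacian u x"
    by blast
qed

theorem corollary1p1:
  fixes p :: real
  assumes "CARD('n::finite) \<ge> 3"
  shows "(1 \<le> p \<and> p \<le> real CARD('n) / (real CARD('n) - 2) \<longrightarrow>
            (\<forall>u :: real ^ 'n \<Rightarrow> real. smooth u \<and> matukuma_solution p u \<longrightarrow> radially_symmetric u))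
       \<and> (0 \<le> p \<and> p < 1 \<longrightarrow>
            \<not> (\<exists>u :: real ^ 'n \<Rightarrow> real. smooth u \<and> matukuma_solution p u))"
proof -
  have pos: "0 < u x" and lap: "laplacian u x = - (u x powr p / (1 + (norm x)\<^sup>2))"
    if "matukuma_solution p u" for u :: "real ^ 'n \<Rightarrow> real" and x
  proof -
    have "- laplacian u x = 1 / (1 + (norm x)\<^sup>2) * u x powr p \<and> 0 < u x"
      using that unfolding matukuma_solution_def by blast
    then show "0 < u x" "laplacian u x = - (u x powr p / (1 + (norm x)\<^sup>2))"
      by auto
  qed
  have "radially_symmetric u"
    if p: "1 \<le> p" "p \<le> real CARD('n) / (real CARD('n) - 2)"
      and u: "smooth u" "matukuma_solution p u" for u :: "real ^ 'n \<Rightarrow> real"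
  proof -
    define g where "g = (\<lambda>x. \<chi> i. partial_deriv i u x)"
    have "Ck 2 u"
      using u(1) by (simp only: smooth_def)
    then have grad: "(u has_derivative (\<lambda>h. g x \<bullet> h)) (at x)"
        "\<exists>H. (g has_derivative H) (at x) \<and> hessian_trace H = laplacian u x" for x
      unfolding g_def by (rule C2_gradient_hessian)+
    have "matukuma p u g e" if "norm e = 1" for e
      using assms p that pos [OF u(2)] grad lap [OF u(2)]
      by unfold_locales auto
    then have le: "u x \<le> u y" if "norm x = norm y" for x y
      using that by (rule equal_norm_imp_le)
    obtain b :: "real ^ 'n" where "norm b = 1"
      using vector_choose_size [of 1] by auto
    then have "u x = u (norm x *\<^sub>R b)" for x
      by (intro antisym le) auto
    then show ?thesis
      unfolding radially_symmetric_def by (intro exI [of _ "\<lambda>r. u (r *\<^sub>R b)"] allI)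
  qed
  moreover have False
    if p: "0 \<le> p" "p < 1" and u: "smooth u" "matukuma_solution p u" for u :: "real ^ 'n \<Rightarrow> real"
  proof (rule no_positive_sublinear_solution [OF p pos [OF u(2)]])
    fix x
    have "Ck 2 u"
      using u(1) by (simp only: smooth_def)
    note grad = C2_gradient_hessian [OF this]
    then obtain H where H: "((\<lambda>x. \<chi> i. partial_deriv i u x) has_derivative H) (at x)"
        "hessian_trace H = laplacian u x"
      by blast
    have "has_hessian u (\<lambda>x. \<chi> i. partial_deriv i u x) H x"
      unfolding has_hessian_def using grad(1) H(1) by (simp add: always_eventually)
    then show "has_laplacian u (- (u x powr p / (1 + (norm x)\<^sup>2))) x"
      by (rule has_laplacianI) (simp add: H(2) lap [OF u(2)])
  qed
  ultimately show ?thesis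
    by blast
qed

end
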